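(* Let $n \ge 2$ be an integer and $D$ a commutative DVD. Every singular $n$-by-$n$ matrix over $D$ is a product of $2n-2$ or fewer idempotent $n$-by-$n$ matrices over $D$ of rank $n-1$.
   Context: A DVD (discrete valuation domain) is a commutative PID with a unique maximal ideal, generated by a non-zero prime element. A matrix is singular if it is a zero divisor in the ring $\mathcal{M}_n(D)$ of $n$-by-$n$ matrices over $D$. *)

theory Defs
  imports
    "HOL-Algebra.Ring_Divisibility"
    "HOL-Computational_Algebra.Polynomial_Factorial"
    "Jordan_Normal_Form.DL_Rank"
begin

text \<open>A PID whose unique maximal ideal is generated by a non-zero prime element
  (non-zeroness is part of \<^const>\<open>ring_prime\<close>).\<close>

definition discrete_valuation_domain :: "('a, 'b) ring_scheme \<Rightarrow> bool" where
  "discrete_valuation_domain R \<longleftrightarrow>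
     principal_domain R \<and>
     (\<exists>p \<in> carrier R. ring_prime\<^bsub>R\<^esub> p \<and> (\<forall>M. maximalideal M R \<longleftrightarrow> M = PIdl\<^bsub>R\<^esub> p))"

text \<open>Left or right zero divisors; zero itself counts as one in any nontrivial ring.\<close>

definition zero_divisor :: "('a, 'b) ring_scheme \<Rightarrow> 'a \<Rightarrow> bool" where
  "zero_divisor R a \<longleftrightarrow>
     a \<in> carrier R \<and>
     (\<exists>b \<in> carrier R. b \<noteq> \<zero>\<^bsub>R\<^esub> \<and> (a \<otimes>\<^bsub>R\<^esub> b = \<zero>\<^bsub>R\<^esub> \<or> b \<otimes>\<^bsub>R\<^esub> a = \<zero>\<^bsub>R\<^esub>))"

definition singular_mat :: "nat \<Rightarrow> 'a :: idom mat \<Rightarrow> bool" where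
  "singular_mat n A \<longleftrightarrow> zero_divisor (ring_mat TYPE('a) n ()) A"

definition idempotent_mat :: "nat \<Rightarrow> 'a :: idom mat \<Rightarrow> bool" where
  "idempotent_mat n A \<longleftrightarrow> A \<in> carrier_mat n n \<and> A * A = A"

text \<open>The rank of a matrix with \<open>n\<close> rows over a domain is the dimension of its column space
  over the field of fractions. Over a PID it is the rank of the free module spanned by the columns.\<close>

definition rank_mat :: "nat \<Rightarrow> 'a :: idom mat \<Rightarrow> nat" where
  "rank_mat n A = vec_space.rank n (map_mat to_fract A)"

definition prod_mats :: "nat \<Rightarrow> 'a :: idom mat list \<Rightarrow> 'a mat" where
  "prod_mats n As = foldr (*) As (1\<^sub>m n)"

end

theory Submission
  imports Defs
begin

text \<open>
  In a discrete valuation domain any two elements are comparable under divisibility, and nothing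
  else about the ring is needed. Induct on the size, conjugation being harmless.

  Let \<open>A\<close> be singular of size \<open>n + 1 \<ge> 3\<close>, with \<open>V A = 0\<close> for a row \<open>V\<close> having an entry \<open>1\<close>, and
  \<open>A U = 0\<close> for a column \<open>U \<noteq> 0\<close>. On two coordinates away from that entry, divisibility yields a
  row \<open>W = e\<^sub>i - c e\<^sub>j\<close> with \<open>W U = 0\<close>, and there is a column \<open>X\<close> with \<open>V X = W X = 1\<close>. Then
  \<open>A = (1 - X V) A'\<close> with \<open>A' = A - X W A\<close>, and now \<open>W A' = 0\<close>, \<open>A' U = 0\<close>, \<open>W U = 0\<close>. In a basis
  where \<open>W\<close> is the first coordinate, \<open>A'\<close> has first row zero and a singular lower right block \<open>B\<close>,
  so it is an idempotent times \<open>diag(1, B)\<close>. Hence a step costs two idempotents; size two is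
  settled by explicit formulas.
\<close>

section \<open>Divisibility in a discrete valuation domain\<close>

text \<open>Every non-unit is a multiple of \<open>p\<close>: an irreducible divisor
  \<open>q\<close> of it generates a maximal ideal, which must be that of \<open>p\<close>. Divide
  \<open>a\<close> and \<open>b\<close> by a generator \<open>d\<close> of the ideal they span.
  Unless \<open>d\<close> is zero, the cofactors satisfy a Bezout identity with value 1, so
  \<open>p\<close> cannot divide both; one cofactor is therefore a unit and divides the
  other.\<close>

lemma discrete_valuation_domain_dvd_total:
  fixes a b :: "'a :: idom"
  assumes "discrete_valuation_domain (class_ring :: 'a ring)"
  shows "a dvd b \<or> b dvd a"
proof -
  let ?R = "class_ring :: 'a ring"
  interpret R: principal_domain ?R
    using assms by (simp add: discrete_valuation_domain_def)
  obtain p where p: "ring_prime\<^bsub>?R\<^esub> p" and max: "\<And>M. maximalideal M ?R \<longleftrightarrow> M = PIdl\<^bsub>?R\<^esub> p"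
    using assms unfolding discrete_valuation_domain_def by blast
  have PIdl_eq: "PIdl\<^bsub>?R\<^esub> x = {y. x dvd y}" for x
    by (auto simp: cgenideal_def dvd_def mult.commute)
  have unit_iff: "x \<in> Units ?R \<longleftrightarrow> x dvd 1" for x
    by (auto simp: Units_def dvd_def mult.commute)
  have p_nonunit: "\<not> p dvd 1"
    using p by (auto simp: ring_prime_def Divisibility.prime_def simp flip: unit_iff)
  have p_dvd: "p dvd x" if "\<not> x dvd 1" for x
  proof (cases "x = 0")
    case False
    hence "x \<in> carrier ?R - {\<zero>\<^bsub>?R\<^esub>}" by simp
    moreover have "x \<notin> Units ?R" using that unit_iff by blast
    ultimately obtain q where qc: "q \<in> carrier ?R"
      and q: "ring_irreducible\<^bsub>?R\<^esub> q" "q divides\<^bsub>?R\<^esub> x"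
      by (rule R.exists_irreducible_divisor)
    have "PIdl\<^bsub>?R\<^esub> q = PIdl\<^bsub>?R\<^esub> p"
      using R.irreducible_imp_maximalideal[OF qc q(1)] max by blast
    hence "{y. q dvd y} = {y. p dvd y}" by (simp only: PIdl_eq)
    hence "p dvd q" using dvd_refl[of q] by (simp only: set_eq_iff mem_Collect_eq)
    moreover have "q dvd x" using q(2) unfolding factor_def dvd_def by simp
    ultimately show ?thesis by (rule dvd_trans)
  qed simp
  have "ring ?R" "cring ?R" by unfold_locales
  hence "ideal (PIdl\<^bsub>?R\<^esub> a <+>\<^bsub>?R\<^esub> PIdl\<^bsub>?R\<^esub> b) ?R"
    by (intro ring.add_ideals cring.cgenideal_ideal) simp_all
  from R.exists_gen[OF this] obtain d
    where sum_eq: "PIdl\<^bsub>?R\<^esub> a <+>\<^bsub>?R\<^esub> PIdl\<^bsub>?R\<^esub> b = PIdl\<^bsub>?R\<^esub> d" by blast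
  \<comment> \<open>Membership in the sum ideal, stated with \<open>dvd\<close> only. It makes
    \<open>d\<close> a common divisor (take one summand 0) and, at \<open>y = d\<close>, a
    combination of \<open>a\<close> and \<open>b\<close>.\<close>
  have d: "d dvd y \<longleftrightarrow> (\<exists>u v. a dvd u \<and> b dvd v \<and> y = u + v)" for y
  proof -
    have "d dvd y \<longleftrightarrow> y \<in> PIdl\<^bsub>?R\<^esub> a <+>\<^bsub>?R\<^esub> PIdl\<^bsub>?R\<^esub> b"
      unfolding sum_eq by (simp only: PIdl_eq mem_Collect_eq)
    thus ?thesis by (auto simp: PIdl_eq set_add_def set_mult_def)
  qed
  have "d dvd a" unfolding d by (rule exI[of _ a], rule exI[of _ 0]) simp
  moreover have "d dvd b" unfolding d by (rule exI[of _ 0], rule exI[of _ b]) simp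
  ultimately obtain a' b' where ab: "a = d * a'" "b = d * b'" by (metis dvdE)
  obtain u v where "a dvd u" "b dvd v" "d = u + v" using iffD1[OF d dvd_refl] by blast
  then obtain r s where "d = a * r + b * s" by (metis dvdE)
  also have "a * r + b * s = d * (a' * r + b' * s)" by (simp add: ab algebra_simps)
  finally have bezout: "d = d * (a' * r + b' * s)" .
  show ?thesis
  proof (cases "d = 0")
    case True
    thus ?thesis using ab by simp
  next
    case False
    hence one: "a' * r + b' * s = 1" using bezout by (metis mult_cancel_left2)
    have "a' dvd 1 \<or> b' dvd 1"
    proof (rule ccontr)
      assume "\<not> (a' dvd 1 \<or> b' dvd 1)"
      hence "p dvd a' * r + b' * s" using p_dvd by (auto intro: dvd_add)
      thus False using p_nonunit one by simp
    qed
    thus ?thesis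
    proof
      assume "a' dvd 1"
      hence "a' dvd b'" by (rule dvd_trans) simp
      thus ?thesis unfolding ab by (simp add: mult_dvd_mono)
    next
      assume "b' dvd 1"
      hence "b' dvd a'" by (rule dvd_trans) simp
      thus ?thesis unfolding ab by (simp add: mult_dvd_mono)
    qed
  qed
qed

section \<open>Kernel columns and the determinant\<close>

text \<open>The criterion \<open>det_0_iff_vec_prod_zero\<close> recast for matrices with one
  column. With rows, columns and scalars all treated as matrices, one associativity law covers every
  product below.\<close>

lemma det_0_iff_col_prod_zero:
  fixes A :: "'a :: idom mat"
  assumes A: "A \<in> carrier_mat n n"
  shows "det A = 0 \<longleftrightarrow> (\<exists>U. U \<in> carrier_mat n 1 \<and> U \<noteq> 0\<^sub>m n 1 \<and> A * U = 0\<^sub>m n 1)"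
proof
  assume "det A = 0"
  then obtain v where v: "v \<in> carrier_vec n" "v \<noteq> 0\<^sub>v n" "A *\<^sub>v v = 0\<^sub>v n"
    using det_0_iff_vec_prod_zero[OF A] by blast
  let ?U = "mat_of_cols n [v]"
  have U: "?U \<in> carrier_mat n 1" by auto
  have colU: "col ?U 0 = v" using v(1) by simp
  have "?U \<noteq> 0\<^sub>m n 1" using colU v(2) by auto
  moreover have "A * ?U = 0\<^sub>m n 1"
  proof (rule mat_col_eqI)
    fix j assume "j < dim_col (0\<^sub>m n 1 :: 'a mat)"
    thus "col (A * ?U) j = col (0\<^sub>m n 1) j"
      using col_mult2[OF A U, of 0] colU v(3) by simp
  qed (use A in auto)
  ultimately show "\<exists>U. U \<in> carrier_mat n 1 \<and> U \<noteq> 0\<^sub>m n 1 \<and> A * U = 0\<^sub>m n 1" using U by blast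
next
  assume "\<exists>U. U \<in> carrier_mat n 1 \<and> U \<noteq> 0\<^sub>m n 1 \<and> A * U = 0\<^sub>m n 1"
  then obtain U where U: "U \<in> carrier_mat n 1" "U \<noteq> 0\<^sub>m n 1" "A * U = 0\<^sub>m n 1" by blast
  have "col U 0 \<noteq> 0\<^sub>v n"
  proof
    assume *: "col U 0 = 0\<^sub>v n"
    have "U = 0\<^sub>m n 1" by (rule mat_col_eqI) (use * U(1) in auto)
    thus False using U(2) by blast
  qed
  moreover have "A *\<^sub>v col U 0 = 0\<^sub>v n" using col_mult2[OF A U(1), of 0] U(3) by simp
  ultimately show "det A = 0"
    using det_0_iff_vec_prod_zero[OF A] U(1) by (metis col_dim carrier_matD(1))
qed

section \<open>Idempotents of corank one\<close>

text \<open>The projection along the column \<open>X\<close> onto the kernel of the row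
  \<open>Y\<close>. Having \<open>X\<close> and \<open>Y\<close> at hand turns idempotency, rank,
  and stability under conjugation and bordering into short computations.\<close>

definition corank_one_idempotent :: "nat \<Rightarrow> 'a :: idom mat \<Rightarrow> bool" where
  "corank_one_idempotent n E \<longleftrightarrow>
     (\<exists>X Y. X \<in> carrier_mat n 1 \<and> Y \<in> carrier_mat 1 n \<and> Y * X = 1\<^sub>m 1 \<and> E = 1\<^sub>m n - X * Y)"

lemma corank_one_idempotentI:
  "X \<in> carrier_mat n 1 \<Longrightarrow> Y \<in> carrier_mat 1 n \<Longrightarrow> Y * X = 1\<^sub>m 1 \<Longrightarrow> E = 1\<^sub>m n - X * Y \<Longrightarrow>
    corank_one_idempotent n E"
  unfolding corank_one_idempotent_def by blast

lemma corank_one_idempotent_carrier: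
  "corank_one_idempotent n E \<Longrightarrow> E \<in> carrier_mat n n"
  unfolding corank_one_idempotent_def by (auto intro!: minus_carrier_mat)

lemma corank_one_idempotent_imp_idempotent:
  assumes "corank_one_idempotent n E"
  shows "idempotent_mat n E"
proof -
  obtain X Y where X[simp]: "X \<in> carrier_mat n 1" and Y[simp]: "Y \<in> carrier_mat 1 n"
    and YX: "Y * X = 1\<^sub>m 1" and E: "E = 1\<^sub>m n - X * Y"
    using assms unfolding corank_one_idempotent_def by blast
  have XY[simp]: "X * Y \<in> carrier_mat n n" by (rule mult_carrier_mat[OF X Y])
  have "X * Y * (X * Y) = X * (Y * X) * Y"
    using assoc_mult_mat[OF XY X Y] assoc_mult_mat[OF X Y X] by simp
  also have "\<dots> = X * Y" using YX right_mult_one_mat[OF X] by simp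
  finally have sq: "X * Y * (X * Y) = X * Y" .
  have cE: "1\<^sub>m n - X * Y \<in> carrier_mat n n" by (rule minus_carrier_mat[OF XY])
  have "(1\<^sub>m n - X * Y) * (1\<^sub>m n - X * Y) = (1\<^sub>m n - X * Y) - (1\<^sub>m n - X * Y) * (X * Y)"
    using mult_minus_distrib_mat[OF cE one_carrier_mat XY] right_mult_one_mat[OF cE] by simp
  also have "(1\<^sub>m n - X * Y) * (X * Y) = 0\<^sub>m n n"
    using minus_mult_distrib_mat[OF one_carrier_mat XY XY] left_mult_one_mat[OF XY]
      minus_r_inv_mat[OF XY] sq by simp
  also have "1\<^sub>m n - X * Y - 0\<^sub>m n n = 1\<^sub>m n - X * Y"
    using carrier_matD[OF XY] by (intro eq_matI) (auto simp del: index_mult_mat)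
  finally show ?thesis
    unfolding E idempotent_mat_def using cE by blast
qed

text \<open>Upper bound: \<open>E * X = 0\<close>, and \<open>X\<close> is non-zero because
  \<open>Y * X = 1\<close>, so \<open>det E = 0\<close>. Lower bound: over the fraction field the
  identity is the sum of \<open>E\<close> and \<open>X * Y\<close>, the latter of rank at most one,
  and rank is subadditive.\<close>

lemma corank_one_idempotent_imp_rank:
  fixes E :: "'a :: idom mat"
  assumes "corank_one_idempotent n E" "n > 0"
  shows "rank_mat n E = n - 1"
proof -
  obtain X Y where X[simp]: "X \<in> carrier_mat n 1" and Y[simp]: "Y \<in> carrier_mat 1 n"
    and YX: "Y * X = 1\<^sub>m 1" and E: "E = 1\<^sub>m n - X * Y"
    using assms unfolding corank_one_idempotent_def by blast
  interpret vec_space "TYPE('a fract)" n .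
  interpret to_fract_hom: inj_comm_ring_hom "to_fract :: 'a \<Rightarrow> 'a fract" by unfold_locales auto
  have XY[simp]: "X * Y \<in> carrier_mat n n" by (rule mult_carrier_mat[OF X Y])
  have Ec: "E \<in> carrier_mat n n" using assms(1) by (rule corank_one_idempotent_carrier)
  have "E * X = X - X * (Y * X)"
    unfolding E using minus_mult_distrib_mat[OF one_carrier_mat XY X] left_mult_one_mat[OF X]
    by (simp only: assoc_mult_mat[OF X Y X])
  hence EX: "E * X = 0\<^sub>m n 1"
    using YX right_mult_one_mat[OF X] minus_r_inv_mat[OF X] by simp
  have "X \<noteq> 0\<^sub>m n 1"
  proof
    assume "X = 0\<^sub>m n 1"
    hence "1\<^sub>m 1 = (0\<^sub>m 1 1 :: 'a mat)" using YX right_mult_zero_mat[OF Y] by simp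
    hence "(1\<^sub>m 1 :: 'a mat) $$ (0,0) = 0" by simp
    thus False by simp
  qed
  with EX have "det E = 0" using det_0_iff_col_prod_zero[OF Ec] X by blast
  hence det0: "det (map_mat to_fract E) = 0"
    by (simp add: to_fract_hom.hom_det)
  let ?E = "map_mat to_fract E" and ?XY = "map_mat to_fract (X * Y)"
  have mE: "?E \<in> carrier_mat n n" and mXY: "?XY \<in> carrier_mat n n" using Ec XY by auto
  have "rank ?E < n"
    using det0 det_rank_iff[OF mE] rank_le_nc[OF mE] by linarith
  moreover have "n \<le> rank ?E + 1"
  proof -
    have "?E + ?XY = 1\<^sub>m n"
      unfolding E using X Y by (intro eq_matI) (auto simp: to_fract_hom.hom_minus)
    hence "rank (?E + ?XY) = n"
      using det_rank_iff[of "1\<^sub>m n"] by simp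
    moreover have "rank ?XY \<le> 1"
      by (rule rank_le_1_product_entries[OF mXY, of "\<lambda>i. to_fract (X $$ (i,0))" "\<lambda>j. to_fract (Y $$ (0,j))"])
        (use X Y in \<open>auto simp: scalar_prod_def to_fract_hom.hom_mult\<close>)
    ultimately show ?thesis using rank_subadditive[OF mE mXY] by linarith
  qed
  ultimately show ?thesis unfolding rank_mat_def by linarith
qed

section \<open>Products of idempotents under conjugation and bordering\<close>

definition idempotent_product :: "nat \<Rightarrow> nat \<Rightarrow> 'a :: idom mat \<Rightarrow> bool" where
  "idempotent_product n k A \<longleftrightarrow>
     (\<exists>Es. length Es \<le> k \<and> (\<forall>E \<in> set Es. corank_one_idempotent n E) \<and> A = prod_mats n Es)"

lemma prod_mats_Nil [simp]: "prod_mats n [] = 1\<^sub>m n"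
  by (simp add: prod_mats_def)

lemma prod_mats_Cons [simp]: "prod_mats n (E # Es) = E * prod_mats n Es"
  by (simp add: prod_mats_def)

lemma prod_mats_carrier:
  "(\<And>E. E \<in> set Es \<Longrightarrow> E \<in> carrier_mat n n) \<Longrightarrow> prod_mats n Es \<in> carrier_mat n n"
  by (induction Es) (auto intro!: mult_carrier_mat)

lemma idempotent_product_mult_left:
  assumes "corank_one_idempotent n E" "idempotent_product n k A"
  shows "idempotent_product n (Suc k) (E * A)"
proof -
  obtain Es where "length Es \<le> k" "\<forall>E \<in> set Es. corank_one_idempotent n E" "A = prod_mats n Es"
    using assms(2) unfolding idempotent_product_def by blast
  thus ?thesis using assms(1) unfolding idempotent_product_def
    by (intro exI[of _ "E # Es"]) auto
qed

text \<open>The conjugate is given by the pair \<open>P * X\<close>, \<open>Y * Q\<close>: the inner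
  \<open>Q * P\<close> cancels in \<open>Y * Q * (P * X)\<close>.\<close>

lemma corank_one_idempotent_conj:
  assumes E: "corank_one_idempotent n E"
    and P: "P \<in> carrier_mat n n" and Q: "Q \<in> carrier_mat n n"
    and PQ: "P * Q = 1\<^sub>m n" and QP: "Q * P = 1\<^sub>m n"
  shows "corank_one_idempotent n (P * E * Q)"
proof -
  obtain X Y where X: "X \<in> carrier_mat n 1" and Y: "Y \<in> carrier_mat 1 n"
    and YX: "Y * X = 1\<^sub>m 1" and E: "E = 1\<^sub>m n - X * Y"
    using E unfolding corank_one_idempotent_def by blast
  have XY: "X * Y \<in> carrier_mat n n" by (rule mult_carrier_mat[OF X Y])
  show ?thesis
  proof (rule corank_one_idempotentI)
    show "P * X \<in> carrier_mat n 1" "Y * Q \<in> carrier_mat 1 n" using P Q X Y by auto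
    have "Y * Q * (P * X) = Y * (Q * P * X)"
      using assoc_mult_mat[OF Y Q mult_carrier_mat[OF P X]] assoc_mult_mat[OF Q P X] by simp
    thus "Y * Q * (P * X) = 1\<^sub>m 1" using QP YX X by simp
    have "P * E * Q = P * Q - P * (X * Y) * Q"
      unfolding E using mult_minus_distrib_mat[OF P one_carrier_mat XY]
        minus_mult_distrib_mat[OF P mult_carrier_mat[OF P XY] Q] right_mult_one_mat[OF P] by simp
    also have "P * (X * Y) * Q = P * X * (Y * Q)"
      using assoc_mult_mat[OF P X Y] assoc_mult_mat[OF mult_carrier_mat[OF P X] Y Q] by simp
    finally show "P * E * Q = 1\<^sub>m n - P * X * (Y * Q)" unfolding PQ .
  qed
qed

lemma idempotent_product_conj:
  assumes "idempotent_product n k A"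
    and P: "P \<in> carrier_mat n n" and Q: "Q \<in> carrier_mat n n"
    and PQ: "P * Q = 1\<^sub>m n" and QP: "Q * P = 1\<^sub>m n"
  shows "idempotent_product n k (P * A * Q)"
proof -
  obtain Es where Es: "length Es \<le> k" "\<forall>E \<in> set Es. corank_one_idempotent n E" "A = prod_mats n Es"
    using assms(1) unfolding idempotent_product_def by blast
  have "prod_mats n (map (\<lambda>E. P * E * Q) Es) = P * prod_mats n Es * Q"
    using Es(2)
  proof (induction Es)
    case Nil
    show ?case using P Q PQ by simp
  next
    case (Cons E Es)
    let ?B = "prod_mats n Es"
    have E: "E \<in> carrier_mat n n" and B: "?B \<in> carrier_mat n n"
      using Cons.prems by (auto intro!: prod_mats_carrier intro: corank_one_idempotent_carrier)
    have "P * E * Q * (P * ?B * Q) = P * E * (Q * P * (?B * Q))"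
      using P Q E B by (simp add: assoc_mult_mat[of _ n n _ n _ n])
    also have "\<dots> = P * (E * ?B) * Q"
      using P Q E B by (simp add: QP assoc_mult_mat[of _ n n _ n _ n])
    finally show ?case using Cons by simp
  qed
  thus ?thesis using Es assms unfolding idempotent_product_def
    by (intro exI[of _ "map (\<lambda>E. P * E * Q) Es"]) (auto intro: corank_one_idempotent_conj)
qed

text \<open>Bordering by a 1 is multiplicative and preserves the identity, so a factorisation in
  size \<open>n\<close> lifts to the next size with the same number of factors.\<close>

abbreviation one_block :: "nat \<Rightarrow> 'a :: idom mat \<Rightarrow> 'a mat" where
  "one_block n B \<equiv> four_block_mat (1\<^sub>m 1) (0\<^sub>m 1 n) (0\<^sub>m n 1) B"

text \<open>Put an entry 0 in front of both \<open>X\<close> and \<open>Y\<close>. The scalar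
  \<open>Y * X\<close> is unchanged, and \<open>X * Y\<close> only gains a zero row and a zero
  column.\<close>

lemma corank_one_idempotent_one_block:
  assumes "corank_one_idempotent n E"
  shows "corank_one_idempotent (Suc n) (one_block n E)"
proof -
  obtain X Y where X: "X \<in> carrier_mat n 1" and Y: "Y \<in> carrier_mat 1 n"
    and YX: "Y * X = 1\<^sub>m 1" and E: "E = 1\<^sub>m n - X * Y"
    using assms unfolding corank_one_idempotent_def by blast
  let ?X = "mat (Suc n) 1 (\<lambda>(i,j). if i = 0 then 0 else X $$ (i - 1, 0))"
  let ?Y = "mat 1 (Suc n) (\<lambda>(i,j). if j = 0 then 0 else Y $$ (0, j - 1))"
  have "(\<Sum>i = 0..<n. Y $$ (0,i) * X $$ (i,0)) = (Y * X) $$ (0,0)"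
    using X Y by (simp add: scalar_prod_def)
  hence sum: "(\<Sum>i = 0..<n. Y $$ (0,i) * X $$ (i,0)) = 1" unfolding YX by simp
  show ?thesis
  proof (rule corank_one_idempotentI)
    show "?X \<in> carrier_mat (Suc n) 1" "?Y \<in> carrier_mat 1 (Suc n)" by auto
    show "?Y * ?X = 1\<^sub>m 1"
      using sum by (intro eq_matI)
        (auto simp: scalar_prod_def sum.atLeast0_lessThan_Suc_shift simp del: sum.op_ivl_Suc)
    show "one_block n E = 1\<^sub>m (Suc n) - ?X * ?Y"
      using X Y by (intro eq_matI) (auto simp: E scalar_prod_def)
  qed
qed

lemma idempotent_product_one_block:
  assumes "idempotent_product n k A"
  shows "idempotent_product (Suc n) k (one_block n A)"
proof -
  obtain Es where Es: "length Es \<le> k" "\<forall>E \<in> set Es. corank_one_idempotent n E" "A = prod_mats n Es"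
    using assms unfolding idempotent_product_def by blast
  have "prod_mats (Suc n) (map (one_block n) Es) = one_block n (prod_mats n Es)"
    using Es(2)
  proof (induction Es)
    case Nil
    show ?case by (intro eq_matI) auto
  next
    case (Cons E Es)
    have E: "E \<in> carrier_mat n n" and B: "prod_mats n Es \<in> carrier_mat n n"
      using Cons.prems by (auto intro!: prod_mats_carrier intro: corank_one_idempotent_carrier)
    have "one_block n E * one_block n (prod_mats n Es) = one_block n (E * prod_mats n Es)"
      using E B by (subst mult_four_block_mat[of _ 1 1 _ n _ n _ _ 1 _ n]) auto
    thus ?case using Cons by simp
  qed
  thus ?thesis using Es unfolding idempotent_product_def
    by (intro exI[of _ "map (one_block n) Es"]) (auto intro: corank_one_idempotent_one_block[simplified])
qed

section \<open>Changing the basis so that a given row becomes a coordinate\<close>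

text \<open>Take \<open>e_i + (1 - V_i) e_k\<close>. The second term corrects the value of
  \<open>V\<close> from \<open>V_i\<close> to 1. It leaves the value of \<open>W\<close> alone,
  since either \<open>W_k = 0\<close> or \<open>i = k\<close>, and then the coefficient
  \<open>1 - V_i\<close> is 0.\<close>

lemma ex_common_section:
  fixes V W :: "'a :: idom mat"
  assumes V: "V \<in> carrier_mat 1 n" and W: "W \<in> carrier_mat 1 n"
    and "i < n" "W $$ (0,i) = 1" "k < n" "V $$ (0,k) = 1" "i = k \<or> W $$ (0,k) = 0"
  obtains X where "X \<in> carrier_mat n 1" "V * X = 1\<^sub>m 1" "W * X = 1\<^sub>m 1"
proof -
  let ?X = "mat n 1 (\<lambda>(l,j). (if l = i then 1 else 0) + (if l = k then 1 - V $$ (0,i) else 0))"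
  have *: "(\<Sum>l = 0..<n. R $$ (0,l) * ((if l = i then 1 else 0) + (if l = k then 1 - V $$ (0,i) else 0)))
      = R $$ (0,i) + R $$ (0,k) * (1 - V $$ (0,i))" for R :: "'a mat"
    unfolding distrib_left sum.distrib using assms by (simp add: if_distrib[of "(*) _"] cong: if_cong)
  have "R * ?X = 1\<^sub>m 1"
    if "R \<in> carrier_mat 1 n" "R $$ (0,i) + R $$ (0,k) * (1 - V $$ (0,i)) = 1" for R
    using that by (intro eq_matI) (auto simp: scalar_prod_def *)
  thus ?thesis using assms by (intro that[of ?X]) auto
qed

text \<open>The difference \<open>D = V - W\<close> kills \<open>Z\<close>, so \<open>Z * D\<close>
  squares to zero and \<open>1 + Z * D\<close> has inverse \<open>1 - Z * D\<close>. Since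
  \<open>W * Z = 1\<close>, it carries \<open>W\<close> to \<open>W + D = V\<close>.\<close>

lemma ex_transvection:
  fixes V W :: "'a :: idom mat"
  assumes V: "V \<in> carrier_mat 1 n" and W: "W \<in> carrier_mat 1 n" and Z: "Z \<in> carrier_mat n 1"
    and VZ: "V * Z = 1\<^sub>m 1" and WZ: "W * Z = 1\<^sub>m 1"
  obtains P Q where "P \<in> carrier_mat n n" "Q \<in> carrier_mat n n"
    "P * Q = 1\<^sub>m n" "Q * P = 1\<^sub>m n" "W * Q = V"
proof -
  define D where "D = V - W"
  have D: "D \<in> carrier_mat 1 n" unfolding D_def by (rule minus_carrier_mat[OF W])
  have T: "Z * D \<in> carrier_mat n n" by (rule mult_carrier_mat[OF Z D])
  have DZ: "D * Z = 0\<^sub>m 1 1"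
    unfolding D_def using minus_mult_distrib_mat[OF V W Z] VZ WZ by simp
  have "Z * D * (Z * D) = Z * (D * Z) * D"
    using assoc_mult_mat[OF T Z D] assoc_mult_mat[OF Z D Z] by simp
  hence TT: "Z * D * (Z * D) = 0\<^sub>m n n"
    unfolding DZ using Z D by simp
  let ?P = "1\<^sub>m n - Z * D" and ?Q = "1\<^sub>m n + Z * D"
  have P: "?P \<in> carrier_mat n n" by (rule minus_carrier_mat[OF T])
  have Q: "?Q \<in> carrier_mat n n" by (rule add_carrier_mat[OF T])
  have "Z * D - 0\<^sub>m n n = Z * D"
    using carrier_matD[OF T] by (intro eq_matI) (auto simp del: index_mult_mat)
  hence PT: "?P * (Z * D) = Z * D"
    using minus_mult_distrib_mat[OF one_carrier_mat T T] TT left_mult_one_mat[OF T] by simp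
  have QT: "?Q * (Z * D) = Z * D"
    using add_mult_distrib_mat[OF one_carrier_mat T T] TT T by (simp add: left_mult_one_mat[OF T])
  have "?P * ?Q = ?P + Z * D"
    using mult_add_distrib_mat[OF P one_carrier_mat T] PT right_mult_one_mat[OF P] by simp
  also have "\<dots> = 1\<^sub>m n"
    using carrier_matD[OF T] by (intro eq_matI) (auto simp del: index_mult_mat)
  finally have PQ: "?P * ?Q = 1\<^sub>m n" .
  have "?Q * ?P = ?Q - Z * D"
    using mult_minus_distrib_mat[OF Q one_carrier_mat T] QT right_mult_one_mat[OF Q] by simp
  also have "\<dots> = 1\<^sub>m n"
    using carrier_matD[OF T] by (intro eq_matI) (auto simp del: index_mult_mat)
  finally have QP: "?Q * ?P = 1\<^sub>m n" .
  have "W * ?Q = W + W * Z * D"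
    using mult_add_distrib_mat[OF W one_carrier_mat T] right_mult_one_mat[OF W] assoc_mult_mat[OF W Z D]
    by simp
  also have "\<dots> = W + D" using WZ left_mult_one_mat[OF D] by simp
  also have "\<dots> = V" unfolding D_def using V W by (intro eq_matI) auto
  finally show ?thesis using that[OF P Q PQ QP] by blast
qed

text \<open>A transvection \<open>Q\<close> taking the first unit row to \<open>V\<close> has
  \<open>V\<close> as its first row, so the first row of \<open>Q * A * P\<close> is
  \<open>V * A * P = 0\<close>.\<close>

lemma ex_conj_to_first_row_zero:
  fixes A :: "'a :: idom mat"
  assumes A: "A \<in> carrier_mat n n" and V: "V \<in> carrier_mat 1 n" and VA: "V * A = 0\<^sub>m 1 n"
    and i: "i < n" "V $$ (0,i) = 1"
  obtains P Q where "P \<in> carrier_mat n n" "Q \<in> carrier_mat n n"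
    "P * Q = 1\<^sub>m n" "Q * P = 1\<^sub>m n" "A = P * (Q * A * P) * Q"
    "\<And>j. j < n \<Longrightarrow> (Q * A * P) $$ (0,j) = 0" "\<And>j. j < n \<Longrightarrow> Q $$ (0,j) = V $$ (0,j)"
proof -
  let ?E = "mat 1 n (\<lambda>(i,j). if j = 0 then 1 else 0) :: 'a mat"
  have E: "?E \<in> carrier_mat 1 n" by simp
  \<comment> \<open>The unit row has its 1 at index 0, and \<open>V\<close> has its 1 at
    \<open>i\<close>. The unit row vanishes at \<open>i\<close> unless \<open>i = 0\<close>, which
    is the side condition required.\<close>
  obtain Z where Z: "Z \<in> carrier_mat n 1" "V * Z = 1\<^sub>m 1" "?E * Z = 1\<^sub>m 1"
    by (rule ex_common_section[OF V E, of 0 i]) (use i in auto)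
  obtain P Q where P: "P \<in> carrier_mat n n" and Q: "Q \<in> carrier_mat n n"
    and PQ: "P * Q = 1\<^sub>m n" and QP: "Q * P = 1\<^sub>m n" and EQ: "?E * Q = V"
    using ex_transvection[OF V E Z] by blast
  have E_row: "(?E * M) $$ (0,j) = M $$ (0,j)" if "M \<in> carrier_mat n n" "j < n" for M j
  proof -
    have "(?E * M) $$ (0,j) = (\<Sum>l = 0..<n. (if l = 0 then 1 else 0) * M $$ (l,j))"
      using that by (simp add: scalar_prod_def)
    also have "\<dots> = M $$ (0,j)" using that by (simp add: if_distrib if_distribR cong: if_cong)
    finally show ?thesis .
  qed
  have "?E * (Q * A * P) = V * A * P"
    using assoc_mult_mat[OF E mult_carrier_mat[OF Q A] P] assoc_mult_mat[OF E Q A] EQ by simp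
  hence row: "?E * (Q * A * P) = 0\<^sub>m 1 n" unfolding VA using P by simp
  have "P * (Q * A * P) * Q = (P * Q) * A * (P * Q)"
    using P Q A by (simp add: assoc_mult_mat[of _ n n _ n _ n])
  hence "A = P * (Q * A * P) * Q" unfolding PQ using A by simp
  moreover have "(Q * A * P) $$ (0,j) = 0" if "j < n" for j
    using E_row[OF mult_carrier_mat[OF mult_carrier_mat[OF Q A] P] that] that
    unfolding row by simp
  moreover have "Q $$ (0,j) = V $$ (0,j)" if "j < n" for j
    using E_row[OF Q that] EQ by simp
  ultimately show ?thesis using that P Q PQ QP by blast
qed

section \<open>Splitting off one idempotent\<close>

lemma idempotent_product_first_row_zero:
  fixes A :: "'a :: idom mat"
  assumes A: "A \<in> carrier_mat (Suc n) (Suc n)" and row: "\<And>j. j < Suc n \<Longrightarrow> A $$ (0,j) = 0"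
    and B: "idempotent_product n k (mat n n (\<lambda>(i,j). A $$ (Suc i, Suc j)))"
  shows "idempotent_product (Suc n) (Suc k) A"
proof -
  let ?B = "mat n n (\<lambda>(i,j). A $$ (Suc i, Suc j))" and ?b = "mat n 1 (\<lambda>(i,j). A $$ (Suc i, 0))"
  \<comment> \<open>With \<open>b\<close> the first column of \<open>A\<close> below its top entry,
    \<open>?F\<close> is the projection along \<open>(1, -b)\<close> onto the columns with first
    entry 0. Multiplying it by \<open>diag(1, B)\<close> puts \<open>b\<close> beside
    \<open>B\<close> under a zero row.\<close>
  let ?F = "four_block_mat (0\<^sub>m 1 1) (0\<^sub>m 1 n) ?b (1\<^sub>m n)"
  let ?X = "mat (Suc n) 1 (\<lambda>(i,j). if i = 0 then 1 else - A $$ (i,0))"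
  let ?Y = "mat 1 (Suc n) (\<lambda>(i,j). if j = 0 then 1 else 0)"
  have "corank_one_idempotent (Suc n) ?F"
  proof (rule corank_one_idempotentI)
    show "?X \<in> carrier_mat (Suc n) 1" "?Y \<in> carrier_mat 1 (Suc n)" by auto
    show "?Y * ?X = 1\<^sub>m 1"
      by (intro eq_matI)
        (auto simp: scalar_prod_def sum.atLeast0_lessThan_Suc_shift simp del: sum.op_ivl_Suc)
    show "?F = 1\<^sub>m (Suc n) - ?X * ?Y"
      by (intro eq_matI) (auto simp: scalar_prod_def)
  qed
  moreover have "?F * one_block n ?B = four_block_mat (0\<^sub>m 1 1) (0\<^sub>m 1 n) ?b ?B"
    by (subst mult_four_block_mat[of _ 1 1 _ n _ n _ _ 1 _ n]) auto
  moreover have "\<dots> = A" using A row by (intro eq_matI) auto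
  ultimately show ?thesis
    using idempotent_product_mult_left[OF _ idempotent_product_one_block[OF B], of ?F] by simp
qed

text \<open>The condition \<open>V * U = 0\<close> is what makes the smaller block singular: once
  \<open>V\<close> is the first coordinate, \<open>U\<close> has first entry 0, so its remaining
  entries form a non-zero column killed by the block.\<close>

lemma idempotent_product_kernel_in_hyperplane:
  fixes A :: "'a :: idom mat"
  assumes IH: "\<And>B :: 'a mat. B \<in> carrier_mat n n \<Longrightarrow> det B = 0 \<Longrightarrow> idempotent_product n k B"
    and A: "A \<in> carrier_mat (Suc n) (Suc n)"
    and V: "V \<in> carrier_mat 1 (Suc n)" and VA: "V * A = 0\<^sub>m 1 (Suc n)"
    and i: "i < Suc n" "V $$ (0,i) = 1"
    and U: "U \<in> carrier_mat (Suc n) 1" "U \<noteq> 0\<^sub>m (Suc n) 1"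
    and AU: "A * U = 0\<^sub>m (Suc n) 1" and VU: "V * U = 0\<^sub>m 1 1"
  shows "idempotent_product (Suc n) (Suc k) A"
proof -
  obtain P Q where P: "P \<in> carrier_mat (Suc n) (Suc n)" and Q: "Q \<in> carrier_mat (Suc n) (Suc n)"
    and PQ: "P * Q = 1\<^sub>m (Suc n)" and QP: "Q * P = 1\<^sub>m (Suc n)" and A_eq: "A = P * (Q * A * P) * Q"
    and row: "\<And>j. j < Suc n \<Longrightarrow> (Q * A * P) $$ (0,j) = 0"
    and Q0: "\<And>j. j < Suc n \<Longrightarrow> Q $$ (0,j) = V $$ (0,j)"
    using ex_conj_to_first_row_zero[OF A V VA i] by blast
  let ?A = "Q * A * P" and ?U = "Q * U"
  let ?B = "mat n n (\<lambda>(i,j). ?A $$ (Suc i, Suc j))" and ?T = "mat n 1 (\<lambda>(i,j). ?U $$ (Suc i, 0))"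
  have A': "?A \<in> carrier_mat (Suc n) (Suc n)" and U': "?U \<in> carrier_mat (Suc n) 1"
    using A P Q U by auto
  have "?A * ?U = Q * A * (P * Q * U)"
    using assoc_mult_mat[OF mult_carrier_mat[OF Q A] P U'] assoc_mult_mat[OF P Q U(1)] by simp
  also have "\<dots> = 0\<^sub>m (Suc n) 1"
    unfolding PQ using assoc_mult_mat[OF Q A U(1)] AU left_mult_one_mat[OF U(1)] Q by simp
  finally have AU': "?A * ?U = 0\<^sub>m (Suc n) 1" .
  have "?U $$ (0,0) = (V * U) $$ (0,0)"
    using Q V U(1) Q0 by (simp add: scalar_prod_def)
  hence U0: "?U $$ (0,0) = 0" unfolding VU by simp
  have "?T \<noteq> 0\<^sub>m n 1"
  proof
    assume *: "?T = 0\<^sub>m n 1"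
    have "?U $$ (Suc l,0) = 0" if "l < n" for l
    proof -
      have "?U $$ (Suc l,0) = ?T $$ (l,0)" using that by simp
      also have "\<dots> = 0" unfolding * using that by simp
      finally show ?thesis .
    qed
    hence "?U $$ (l,0) = 0" if "l < Suc n" for l using that U0 by (cases l) auto
    hence "?U = 0\<^sub>m (Suc n) 1" using U' by (intro eq_matI) auto
    hence "P * ?U = 0\<^sub>m (Suc n) 1" using P by simp
    hence "U = 0\<^sub>m (Suc n) 1"
      using assoc_mult_mat[OF P Q U(1)] PQ left_mult_one_mat[OF U(1)] by simp
    thus False using U(2) by blast
  qed
  moreover have "?B * ?T = 0\<^sub>m n 1"
  proof (rule eq_matI)
    fix r c assume "r < dim_row (0\<^sub>m n 1 :: 'a mat)" "c < dim_col (0\<^sub>m n 1 :: 'a mat)"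
    hence r: "r < n" and c: "c = 0" by auto
    have "(?B * ?T) $$ (r,c) = (\<Sum>l = 0..<n. ?A $$ (Suc r, Suc l) * ?U $$ (Suc l, 0))"
      using r c by (simp add: scalar_prod_def)
    \<comment> \<open>The added term at index 0 vanishes because the first entry of
      \<open>Q * U\<close> is 0.\<close>
    also have "\<dots> = (\<Sum>l = 0..<Suc n. ?A $$ (Suc r, l) * ?U $$ (l, 0))"
      unfolding sum.atLeast0_lessThan_Suc_shift using U0 by simp
    also have "\<dots> = (?A * ?U) $$ (Suc r, 0)"
      using carrier_matD[OF A'] carrier_matD[OF U'] r
      by (subst index_mult_mat(1)) (simp_all add: scalar_prod_def del: sum.op_ivl_Suc index_mult_mat(1))
    also have "\<dots> = 0" unfolding AU' using r by simp
    finally show "(?B * ?T) $$ (r,c) = (0\<^sub>m n 1) $$ (r,c)" using r c by simp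
  qed auto
  ultimately have "det ?B = 0"
    using det_0_iff_col_prod_zero[of ?B n] by (meson mat_carrier)
  hence "idempotent_product n k ?B" using IH by simp
  hence "idempotent_product (Suc n) (Suc k) ?A"
    using idempotent_product_first_row_zero[OF A'] row by blast
  thus ?thesis using idempotent_product_conj[OF _ P Q PQ QP] A_eq by metis
qed

section \<open>Rows with an entry 1 obtained from total divisibility\<close>

lemma finite_ex_dvd_all:
  fixes f :: "'b \<Rightarrow> 'a :: idom"
  assumes total: "\<And>a b :: 'a. a dvd b \<or> b dvd a" and "finite S" "S \<noteq> {}"
  shows "\<exists>k\<in>S. \<forall>i\<in>S. f k dvd f i"
  using assms(2,3)
proof (induction S rule: finite_ne_induct)
  case (insert x S)
  then obtain k where k: "k \<in> S" "\<forall>i\<in>S. f k dvd f i" by blast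
  show ?case
  proof (cases "f k dvd f x")
    case True
    thus ?thesis using k by auto
  next
    case False
    hence "f x dvd f k" using total by blast
    thus ?thesis using k by (auto intro: dvd_trans)
  qed
qed simp

text \<open>Among the entries of a non-zero kernel column of the transpose, one divides all the
  others. It is non-zero, and dividing the column by it keeps the kernel equation and yields an
  entry 1.\<close>

lemma det_0_imp_unimodular_left_kernel:
  fixes A :: "'a :: idom mat"
  assumes total: "\<And>a b :: 'a. a dvd b \<or> b dvd a"
    and A: "A \<in> carrier_mat n n" and "det A = 0"
  obtains V k where "V \<in> carrier_mat 1 n" "V * A = 0\<^sub>m 1 n" "k < n" "V $$ (0,k) = 1"
proof -
  have "det (transpose_mat A) = 0" using assms by (simp add: det_transpose[OF A])
  then obtain U where U: "U \<in> carrier_mat n 1" "U \<noteq> 0\<^sub>m n 1" "transpose_mat A * U = 0\<^sub>m n 1"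
    using det_0_iff_col_prod_zero[of "transpose_mat A" n] A by auto
  have "{..<n} \<noteq> {}" using U(1,2) by (auto simp: mat_eq_iff)
  then obtain k where k: "k < n" "\<And>i. i < n \<Longrightarrow> U $$ (k,0) dvd U $$ (i,0)"
    using finite_ex_dvd_all[OF total, of "{..<n}" "\<lambda>i. U $$ (i,0)"] by auto
  have nz: "U $$ (k,0) \<noteq> 0"
  proof
    assume "U $$ (k,0) = 0"
    hence "U = 0\<^sub>m n 1" using k(2) U(1) by (intro eq_matI) auto
    thus False using U(2) by blast
  qed
  obtain w where w: "\<And>i. i < n \<Longrightarrow> U $$ (i,0) = U $$ (k,0) * w i"
    using k(2) unfolding dvd_def by metis
  let ?V = "mat 1 n (\<lambda>(i,j). w j)"
  have "?V * A = 0\<^sub>m 1 n"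
  proof (rule eq_matI)
    fix r c assume "r < dim_row (0\<^sub>m 1 n :: 'a mat)" "c < dim_col (0\<^sub>m 1 n :: 'a mat)"
    hence r: "r = 0" and c: "c < n" by auto
    \<comment> \<open>The product is computed after scaling by the non-zero entry, which is
      cancelled at the end.\<close>
    have "U $$ (k,0) * (?V * A) $$ (r,c) = (\<Sum>l = 0..<n. (U $$ (k,0) * w l) * A $$ (l,c))"
      using r c A by (simp add: scalar_prod_def sum_distrib_left mult.assoc)
    also have "\<dots> = (\<Sum>l = 0..<n. A $$ (l,c) * U $$ (l,0))"
      by (intro sum.cong) (simp_all flip: w)
    also have "\<dots> = (transpose_mat A * U) $$ (c,0)"
      using c A U(1) by (simp add: scalar_prod_def)
    also have "\<dots> = 0" unfolding U(3) using c by simp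
    finally show "(?V * A) $$ (r,c) = (0\<^sub>m 1 n) $$ (r,c)" using nz r c by simp
  qed (use A in auto)
  moreover have "?V $$ (0,k) = 1" using w[OF k(1)] nz k(1) by simp
  ultimately show ?thesis using that k(1) by (meson mat_carrier)
qed

text \<open>The bound \<open>n >= 3\<close> leaves two indices other than \<open>k\<close>. The row
  is supported on these two, so it vanishes at \<open>k\<close>, as \<open>ex_common_section\<close>
  demands.\<close>

lemma ex_unimodular_row_in_annihilator:
  fixes U :: "'a :: idom mat"
  assumes total: "\<And>a b :: 'a. a dvd b \<or> b dvd a"
    and U: "U \<in> carrier_mat n 1" and n: "n \<ge> 3" and k: "k < n"
  obtains W i where "W \<in> carrier_mat 1 n" "W * U = 0\<^sub>m 1 1" "i < n" "W $$ (0,i) = 1" "W $$ (0,k) = 0"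
proof -
  have "\<exists>i j. i < n \<and> j < n \<and> i \<noteq> j \<and> i \<noteq> k \<and> j \<noteq> k"
  proof -
    consider "k = 0" | "k = 1" | "k \<ge> 2" by linarith
    thus ?thesis
    proof cases
      case 1 thus ?thesis using n by (intro exI[of _ 1] exI[of _ 2]) auto
    next
      case 2 thus ?thesis using n by (intro exI[of _ 0] exI[of _ 2]) auto
    next
      case 3 thus ?thesis using n by (intro exI[of _ 0] exI[of _ 1]) auto
    qed
  qed
  \<comment> \<open>Totality allows \<open>i\<close> and \<open>j\<close> to be swapped so that the
    divisibility goes this way.\<close>
  then obtain i j where ij: "i < n" "j < n" "i \<noteq> j" "i \<noteq> k" "j \<noteq> k" "U $$ (j,0) dvd U $$ (i,0)"
    using total by metis
  then obtain c where c: "U $$ (i,0) = U $$ (j,0) * c" by (auto elim: dvdE)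
  let ?W = "mat 1 n (\<lambda>(r,l). if l = i then 1 else if l = j then - c else 0)"
  have "(\<Sum>l = 0..<n. (if l = i then 1 else if l = j then - c else 0) * U $$ (l,0))
      = (\<Sum>l = 0..<n. (if l = i then U $$ (l,0) else 0) + (if l = j then - c * U $$ (l,0) else 0))"
    using ij by (intro sum.cong) auto
  also have "\<dots> = 0" using ij c by (simp add: sum.distrib)
  finally have "?W * U = 0\<^sub>m 1 1" using U by (intro eq_matI) (auto simp: scalar_prod_def)
  thus ?thesis using ij k by (intro that[of ?W i]) auto
qed

section \<open>The induction step\<close>

lemma idempotent_product_Suc:
  fixes A :: "'a :: idom mat"
  assumes total: "\<And>a b :: 'a. a dvd b \<or> b dvd a"
    and IH: "\<And>B :: 'a mat. B \<in> carrier_mat n n \<Longrightarrow> det B = 0 \<Longrightarrow> idempotent_product n k B"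
    and A: "A \<in> carrier_mat (Suc n) (Suc n)" and det: "det A = 0" and n: "n \<ge> 2"
  shows "idempotent_product (Suc n) (Suc (Suc k)) A"
proof -
  let ?m = "Suc n"
  obtain V l where V: "V \<in> carrier_mat 1 ?m" "V * A = 0\<^sub>m 1 ?m" and l: "l < ?m" "V $$ (0,l) = 1"
    using det_0_imp_unimodular_left_kernel[OF total A det] by blast
  obtain U where U: "U \<in> carrier_mat ?m 1" "U \<noteq> 0\<^sub>m ?m 1" "A * U = 0\<^sub>m ?m 1"
    using det_0_iff_col_prod_zero[OF A] det by blast
  obtain W i where W: "W \<in> carrier_mat 1 ?m" "W * U = 0\<^sub>m 1 1"
    and i: "i < ?m" "W $$ (0,i) = 1" "W $$ (0,l) = 0"
    using ex_unimodular_row_in_annihilator[OF total U(1) _ l(1)] n by auto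
  obtain X where X: "X \<in> carrier_mat ?m 1" "V * X = 1\<^sub>m 1" "W * X = 1\<^sub>m 1"
    using ex_common_section[OF V(1) W(1) i(1,2) l] i(3) by blast
  have WA: "W * A \<in> carrier_mat 1 ?m" by (rule mult_carrier_mat[OF W(1) A])
  have XWA: "X * (W * A) \<in> carrier_mat ?m ?m" by (rule mult_carrier_mat[OF X(1) WA])
  have XV: "X * V \<in> carrier_mat ?m ?m" by (rule mult_carrier_mat[OF X(1) V(1)])
  \<comment> \<open>This is \<open>(1 - X * W) * A\<close>. A left multiple of \<open>A\<close>
    still kills \<open>U\<close>, and \<open>W * X = 1\<close> makes \<open>W\<close> kill it from
    the left.\<close>
  define A' where "A' = A - X * (W * A)"
  have A': "A' \<in> carrier_mat ?m ?m" unfolding A'_def by (rule minus_carrier_mat[OF XWA])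
  have "W * A' = W * A - W * X * (W * A)"
    unfolding A'_def using mult_minus_distrib_mat[OF W(1) A XWA] assoc_mult_mat[OF W(1) X(1) WA] by simp
  hence WA': "W * A' = 0\<^sub>m 1 ?m" using X(3) left_mult_one_mat[OF WA] minus_r_inv_mat[OF WA] by simp
  have "A' * U = A * U - X * (W * (A * U))"
    unfolding A'_def using minus_mult_distrib_mat[OF A XWA U(1)]
      assoc_mult_mat[OF X(1) WA U(1)] assoc_mult_mat[OF W(1) A U(1)] by simp
  hence A'U: "A' * U = 0\<^sub>m ?m 1"
    unfolding U(3) using X(1) W(1) by simp
  have "V * A' = V * A - V * X * (W * A)"
    unfolding A'_def using mult_minus_distrib_mat[OF V(1) A XWA] assoc_mult_mat[OF V(1) X(1) WA] by simp
  \<comment> \<open>From \<open>V * X = 1\<close> and \<open>V * A = 0\<close>. Hence subtracting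
    \<open>X * (V * A')\<close> from \<open>A'\<close> restores exactly the term
    \<open>X * (W * A)\<close> removed from \<open>A\<close>.\<close>
  hence VA': "V * A' = 0\<^sub>m 1 ?m - W * A" using X(2) V(2) left_mult_one_mat[OF WA] by simp
  have "(1\<^sub>m ?m - X * V) * A' = A' - X * (V * A')"
    using minus_mult_distrib_mat[OF one_carrier_mat XV A'] left_mult_one_mat[OF A']
      assoc_mult_mat[OF X(1) V(1) A'] by simp
  also have "X * (V * A') = 0\<^sub>m ?m ?m - X * (W * A)"
    unfolding VA' using mult_minus_distrib_mat[OF X(1) zero_carrier_mat WA] X(1) by simp
  also have "A' - (0\<^sub>m ?m ?m - X * (W * A)) = A"
    unfolding A'_def using A XWA by (intro eq_matI) auto
  finally have "(1\<^sub>m ?m - X * V) * A' = A" .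
  moreover have "corank_one_idempotent ?m (1\<^sub>m ?m - X * V)"
    using X(1) V(1) X(2) by (rule corank_one_idempotentI) simp
  moreover have "idempotent_product ?m (Suc k) A'"
    using idempotent_product_kernel_in_hyperplane[OF IH A' W(1) WA' i(1,2) U(1,2) A'U W(2)] by blast
  ultimately show ?thesis using idempotent_product_mult_left by metis
qed

section \<open>Size two\<close>

text \<open>Conjugation reduces to a zero first row. The second row \<open>(b, a)\<close> is then
  treated according to which of its entries divides the other.\<close>

lemma idempotent_product_two:
  fixes A :: "'a :: idom mat"
  assumes total: "\<And>a b :: 'a. a dvd b \<or> b dvd a"
    and A: "A \<in> carrier_mat 2 2" and det: "det A = 0"
  shows "idempotent_product 2 2 A"
proof -
  define M where "M = (\<lambda>p q r s :: 'a. mat 2 2 (\<lambda>(i,j). if i = 0 then (if j = 0 then p else q) else (if j = 0 then r else s)))"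
  have M_eqI: "M p q r s = B"
    if "B \<in> carrier_mat 2 2" "B $$ (0,0) = p" "B $$ (0,1) = q" "B $$ (1,0) = r" "B $$ (1,1) = s" for p q r s B
    using that by (intro eq_matI) (auto simp: M_def less_2_cases_iff)
  have M_mult: "M p q r s * M p' q' r' s' = M (p * p' + q * r') (p * q' + q * s') (r * p' + s * r') (r * q' + s * s')"
    for p q r s p' q' r' s'
    by (intro M_eqI[symmetric]) (auto simp: M_def scalar_prod_def numeral_2_eq_2)
  \<comment> \<open>The general \<open>1 - X * Y\<close> in size two, with
    \<open>X = (x, x')\<close> and \<open>Y = (y, y')\<close>.\<close>
  have M_idem: "corank_one_idempotent 2 (M (1 - x * y) (- (x * y')) (- (x' * y)) (1 - x' * y'))"
    if "y * x + y' * x' = 1" for x x' y y'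
  proof (rule corank_one_idempotentI)
    let ?X = "mat 2 1 (\<lambda>(i,j). if i = 0 then x else x')" and ?Y = "mat 1 2 (\<lambda>(i,j). if j = 0 then y else y')"
    show "?X \<in> carrier_mat 2 1" "?Y \<in> carrier_mat 1 2" by auto
    show "?Y * ?X = 1\<^sub>m 1" using that by (intro eq_matI) (auto simp: scalar_prod_def numeral_2_eq_2)
    show "M (1 - x * y) (- (x * y')) (- (x' * y)) (1 - x' * y') = 1\<^sub>m 2 - ?X * ?Y"
      by (intro M_eqI) (auto simp: scalar_prod_def)
  qed
  have triv: "idempotent_product 2 0 (1\<^sub>m 2 :: 'a mat)"
    unfolding idempotent_product_def by (intro exI[of _ "[]"]) simp
  have prod2: "idempotent_product 2 2 (E * F)"
    if "corank_one_idempotent 2 E" "corank_one_idempotent 2 F" for E F :: "'a mat"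
    using idempotent_product_mult_left[OF that(1) idempotent_product_mult_left[OF that(2) triv]]
      corank_one_idempotent_carrier[OF that(2)] by (simp add: numeral_2_eq_2)
  have row_zero: "idempotent_product 2 2 (M 0 0 b a)" for a b
    using total[of a b]
  proof
    assume "a dvd b"
    then obtain c where b: "b = a * c" by (auto elim: dvdE)
    \<comment> \<open>The target row is \<open>a (c, 1)\<close>. The rows of the right factor below
      are \<open>(c, 1)\<close> and \<open>(1 - c) (c, 1)\<close>, so the left factor needs a second
      row \<open>(t, 1)\<close> with \<open>t + (1 - c) = a\<close>.\<close>
    have "corank_one_idempotent 2 (M 0 0 (a - 1 + c) 1)"
      using M_idem[of 1 1 0 "- (a - 1 + c)"] by (simp add: algebra_simps)
    moreover have "corank_one_idempotent 2 (M c 1 (c * (1 - c)) (1 - c))"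
      using M_idem[of "1 - c" 1 "- 1" "- c"] by simp
    moreover have "M 0 0 (a - 1 + c) 1 * M c 1 (c * (1 - c)) (1 - c) = M 0 0 b a"
      unfolding M_mult b by (simp add: algebra_simps)
    ultimately show ?thesis using prod2 by metis
  next
    assume "b dvd a"
    then obtain c where a: "a = b * c" by (auto elim: dvdE)
    \<comment> \<open>Here the target row is \<open>b (1, c)\<close>. Adding the first row
      \<open>(1 - a) (1, c)\<close> gives a matrix of trace 1 with proportional rows, hence an
      idempotent; the left factor erases that first row.\<close>
    have "corank_one_idempotent 2 (M 0 0 0 1)"
      using M_idem[of 1 1 0 0] by simp
    moreover have "corank_one_idempotent 2 (M (1 - a) (c * (1 - a)) b a)"
      using M_idem[of "- b" "- c" "1 - a" 1] by (simp add: a algebra_simps)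
    moreover have "M 0 0 0 1 * M (1 - a) (c * (1 - a)) b a = M 0 0 b a"
      unfolding M_mult by simp
    ultimately show ?thesis using prod2 by metis
  qed
  obtain V l where V: "V \<in> carrier_mat 1 2" "V * A = 0\<^sub>m 1 2" and l: "l < 2" "V $$ (0,l) = 1"
    using det_0_imp_unimodular_left_kernel[OF total A det] by blast
  obtain P Q where P: "P \<in> carrier_mat 2 2" and Q: "Q \<in> carrier_mat 2 2"
    and PQ: "P * Q = 1\<^sub>m 2" and QP: "Q * P = 1\<^sub>m 2" and A_eq: "A = P * (Q * A * P) * Q"
    and row: "\<And>j. j < 2 \<Longrightarrow> (Q * A * P) $$ (0,j) = 0"
    and "\<And>j. j < 2 \<Longrightarrow> Q $$ (0,j) = V $$ (0,j)"
    using ex_conj_to_first_row_zero[OF A V l] by blast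
  have "Q * A * P = M 0 0 ((Q * A * P) $$ (1,0)) ((Q * A * P) $$ (1,1))"
    by (rule M_eqI[symmetric, OF mult_carrier_mat[OF mult_carrier_mat[OF Q A] P]])
      (simp_all only: row zero_less_numeral one_less_numeral_iff semiring_norm)
  hence "idempotent_product 2 2 (Q * A * P)" using row_zero by metis
  thus ?thesis using idempotent_product_conj[OF _ P Q PQ QP] A_eq by metis
qed

section \<open>Counting factors, and singularity as vanishing determinant\<close>

lemma idempotent_product_of_det_0:
  fixes A :: "'a :: idom mat"
  assumes total: "\<And>a b :: 'a. a dvd b \<or> b dvd a"
    and "n \<ge> 2" "A \<in> carrier_mat n n" "det A = 0"
  shows "idempotent_product n (2 * n - 2) A"
  using assms(2-)
proof (induction n arbitrary: A rule: nat_induct_at_least)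
  case base
  thus ?case using idempotent_product_two[OF total] by simp
next
  case (Suc n)
  \<comment> \<open>Each increase in size allows two more factors; the truncated subtraction is
    exact because \<open>n >= 2\<close>.\<close>
  have "2 * Suc n - 2 = Suc (Suc (2 * n - 2))" using Suc.hyps by simp
  thus ?case using idempotent_product_Suc[OF total Suc.IH Suc.prems Suc.hyps] by simp
qed

text \<open>Multiplying \<open>A * B = 0\<close> by the adjugate on the left, or
  \<open>B * A = 0\<close> on the right, gives \<open>det A\<close> times \<open>B\<close> equal to
  zero. Some entry of \<open>B\<close> is non-zero and can be cancelled.\<close>

lemma singular_mat_imp_det_0:
  fixes A :: "'a :: idom mat"
  assumes "singular_mat n A"
  shows "A \<in> carrier_mat n n" "det A = 0"
proof -
  obtain B where A: "A \<in> carrier_mat n n" and B: "B \<in> carrier_mat n n" "B \<noteq> 0\<^sub>m n n"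
    and AB: "A * B = 0\<^sub>m n n \<or> B * A = 0\<^sub>m n n"
    using assms unfolding singular_mat_def zero_divisor_def by (auto simp: ring_mat_simps)
  show "A \<in> carrier_mat n n" by (rule A)
  note adj = adj_mat[OF A]
  from AB have "det A \<cdot>\<^sub>m B = 0\<^sub>m n n"
  proof
    assume "A * B = 0\<^sub>m n n"
    hence "adj_mat A * A * B = 0\<^sub>m n n" using assoc_mult_mat[OF adj(1) A B(1)] adj(1) by simp
    thus ?thesis unfolding adj(3) using mult_smult_assoc_mat[OF one_carrier_mat B(1)] B(1) by simp
  next
    assume "B * A = 0\<^sub>m n n"
    hence "B * (A * adj_mat A) = 0\<^sub>m n n" using assoc_mult_mat[OF B(1) A adj(1)] adj(1) by simp
    thus ?thesis unfolding adj(2) using mult_smult_distrib[OF B(1) one_carrier_mat] B(1) by simp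
  qed
  hence "det A * B $$ (i,j) = 0" if "i < n" "j < n" for i j
    using that B(1) by (metis index_smult_mat(1) index_zero_mat(1) carrier_matD)
  moreover obtain i j where "i < n" "j < n" "B $$ (i,j) \<noteq> 0"
    using B by (auto simp: mat_eq_iff)
  ultimately show "det A = 0" by (metis mult_eq_0_iff)
qed

theorem corollary5p20:
  fixes n :: nat and A :: "'a :: idom mat"
  assumes "n \<ge> 2"
    and "discrete_valuation_domain (class_ring :: 'a ring)"
    and "singular_mat n A"
  shows "\<exists>Es :: 'a mat list.
           length Es \<le> 2 * n - 2 \<and>
           (\<forall>E \<in> set Es. idempotent_mat n E \<and> rank_mat n E = n - 1) \<and>
           A = prod_mats n Es"
proof -
  have "idempotent_product n (2 * n - 2) A"
    using idempotent_product_of_det_0[OF discrete_valuation_domain_dvd_total[OF assms(2)] assms(1)]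
      singular_mat_imp_det_0[OF assms(3)] by blast
  then obtain Es where "length Es \<le> 2 * n - 2" "\<forall>E \<in> set Es. corank_one_idempotent n E"
    "A = prod_mats n Es"
    unfolding idempotent_product_def by blast
  thus ?thesis using assms(1)
    by (intro exI[of _ Es])
      (auto simp: corank_one_idempotent_imp_idempotent corank_one_idempotent_imp_rank)
qed

end
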